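(* Let $(X_\eta,S)$ be a $\mathscr{B}$-free subshift. If $X_\eta$ is hereditary, then $\mathrm{Aut}(X_\eta,S)$ is trivial, that is, $\mathrm{Aut}(X_\eta,S)=\{S^n: n\in\mathbb{Z}\}$.
   Context: $\mathscr{B}\subset\mathbb{N}=\{1,2,\dots\}$ is assumed primitive (no element of $\mathscr{B}$ divides another element of $\mathscr{B}$) and $\mathscr{B}\neq\{1\}$. Put $\mathcal{F}_{\mathscr{B}}=\mathbb{Z}\setminus\bigcup_{b\in\mathscr{B}}b\mathbb{Z}$ and let $\eta\in\{0,1\}^{\mathbb{Z}}$ be its characteristic function. Let $S$ be the left shift on $\{0,1\}^{\mathbb{Z}}$ (product topology), $(Sx)(j)=x(j+1)$. The $\mathscr{B}$-free subshift is $(X_\eta,S)$ with $X_\eta=\overline{\{S^r\eta: r\in\mathbb{Z}\}}$. A set $X\subset\{0,1\}^{\mathbb{Z}}$ is hereditary if $y\in X$ whenever $y\in\{0,1\}^{\mathbb{Z}}$ and $y\le x$ coordinatewise for some $x\in X$. $\mathrm{Aut}(X,S)$ is the group of homeomorphisms $\tau:X\to X$ commuting with $S$ (elements of $\{S^n\}$ are understood restricted to $X$). *)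

theory Defs
  imports "HOL-Analysis.Analysis"
begin

text \<open>
  The full shift \<open>{0,1}\<^sup>\<int>\<close> is the type \<^typ>\<open>int \<Rightarrow> bool\<close>, with \<^const>\<open>False\<close> for \<open>0\<close> and
  \<^const>\<open>True\<close> for \<open>1\<close>. The order \<open>\<le>\<close> on this type is the coordinatewise one, and its type-class
  topology is the product of the order topologies on \<^typ>\<open>bool\<close>, which are discrete:
\<close>

lemma open_bool_set: "open (A :: bool set)"
  by (rule open_discrete)

definition shift :: "(int \<Rightarrow> bool) \<Rightarrow> int \<Rightarrow> bool" where
  "shift x = (\<lambda>j. x (j + 1))"

text \<open>Integer iterates of a map; only meaningful for negative exponents if the map is bijective.\<close>

definition int_iterate :: "('a \<Rightarrow> 'a) \<Rightarrow> int \<Rightarrow> 'a \<Rightarrow> 'a" where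
  "int_iterate f n = (if 0 \<le> n then f ^^ nat n else inv f ^^ nat (- n))"

lemma bij_shift: "bij shift"
  by (rule o_bij[of "\<lambda>x j. x (j - 1)"]) (auto simp: shift_def)

lemma int_iterate_shift: "int_iterate shift n x j = x (j + n)"
proof -
  have pos: "(shift ^^ k) x j = x (j + int k)" for k x j
    by (induction k arbitrary: j) (auto simp: shift_def algebra_simps)
  have "inv shift = (\<lambda>x j. x (j - 1))"
    by (rule inv_unique_comp) (auto simp: shift_def)
  then have neg: "(inv shift ^^ k) x j = x (j - int k)" for k x j
    by (induction k arbitrary: j) (auto simp: algebra_simps)
  show ?thesis
    by (simp add: int_iterate_def pos neg)
qed

definition primitive_set :: "nat set \<Rightarrow> bool" where
  "primitive_set B \<longleftrightarrow> (\<forall>a\<in>B. \<forall>b\<in>B. a dvd b \<longrightarrow> a = b)"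

definition free_integers :: "nat set \<Rightarrow> int set" where
  "free_integers B = UNIV - (\<Union>b\<in>B. range (\<lambda>k. int b * k))"

definition eta :: "nat set \<Rightarrow> int \<Rightarrow> bool" where
  "eta B = (\<lambda>j. j \<in> free_integers B)"

definition X_eta :: "nat set \<Rightarrow> (int \<Rightarrow> bool) set" where
  "X_eta B = closure (range (\<lambda>r. int_iterate shift r (eta B)))"

definition hereditary :: "(int \<Rightarrow> bool) set \<Rightarrow> bool" where
  "hereditary X \<longleftrightarrow> (\<forall>x\<in>X. \<forall>y. y \<le> x \<longrightarrow> y \<in> X)"

text \<open>
  A self-map of \<open>X\<close> is represented by its extensional representative (value \<^const>\<open>undefined\<close>
  off \<open>X\<close>), so that equality of maps \<open>X \<rightarrow> X\<close> is equality in HOL.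
\<close>

definition Aut :: "'a::topological_space set \<Rightarrow> ('a \<Rightarrow> 'a) \<Rightarrow> ('a \<Rightarrow> 'a) set" where
  "Aut X T = {\<tau> \<in> extensional X.
     (\<exists>\<sigma>. homeomorphism X X \<tau> \<sigma>) \<and> (\<forall>x\<in>X. \<tau> (T x) = T (\<tau> x))}"

end

theory Submission
  imports Defs
begin

text \<open>
  Write \<open>F\<close> for the set of \<open>B\<close>-free integers and identify points of \<open>X\<close> with subsets of \<open>\<int>\<close>. By
  heredity a finite \<open>A \<in> X\<close> occurs in \<open>F\<close> exactly, with any prescribed further point outside \<open>A\<close>
  falling into some \<open>b\<int>\<close>, and it occurs arbitrarily far out. Counting residues, the far part of
  \<open>F\<close> meets the same classes mod \<open>b\<close> as \<open>F\<close>, so some sparse finite \<open>E \<subseteq> F\<close> far from any given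
  window meets all of them. Such an \<open>E\<close> is rigid: if \<open>E + r \<subseteq> F\<close> and \<open>p + r \<in> F\<close>, then \<open>b\<close> does
  not divide \<open>p\<close>.

  An automorphism \<open>\<tau>\<close> is a sliding block code with \<open>\<tau>(\<emptyset>) = \<emptyset>\<close>, hence additive on far apart sets; put
  \<open>G = \<tau>({0})\<close>, so that \<open>\<tau>(E) = E + G\<close> for sparse \<open>E\<close>. Rigidity of \<open>E\<close> makes \<open>F\<close> invariant under
  \<open>G - G\<close>, and \<open>F\<close> is not periodic because \<open>\<emptyset> \<in> X\<close>; so \<open>G = {m}\<close>. Now let \<open>p \<in> \<tau>(A)\<close> with
  \<open>p - m \<notin> A\<close>, translated so that \<open>A \<subseteq> F\<close> and \<open>b\<close> divides \<open>p - m\<close>; then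
  \<open>\<tau>(A \<union> E) = \<tau>(A) \<union> (E + m) \<in> X\<close> contradicts rigidity. So \<open>\<tau>(A) \<subseteq> A + m\<close> for finite \<open>A\<close>, and
  injectivity forces equality by induction on \<open>A\<close>.
\<close>

section \<open>Topology of the full shift through symmetric windows\<close>

lemma open_bool_fun_iff:
  fixes U :: "(int \<Rightarrow> bool) set"
  shows "open U \<longleftrightarrow> (\<forall>x\<in>U. \<exists>N. \<forall>y. (\<forall>j. \<bar>j\<bar> \<le> N \<longrightarrow> y j = x j) \<longrightarrow> y \<in> U)"
proof
  assume U: "open U"
  show "\<forall>x\<in>U. \<exists>N. \<forall>y. (\<forall>j. \<bar>j\<bar> \<le> N \<longrightarrow> y j = x j) \<longrightarrow> y \<in> U"
  proof
    fix x assume "x \<in> U"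
    moreover have "openin (product_topology (\<lambda>i::int. euclidean :: bool topology) UNIV) U"
      using U by (simp add: open_fun_def)
    ultimately obtain V where V: "x \<in> (\<Pi>\<^sub>E i\<in>UNIV. V i)" "finite {i. V i \<noteq> UNIV}" "(\<Pi>\<^sub>E i\<in>UNIV. V i) \<subseteq> U"
      using product_topology_open_contains_basis[of "\<lambda>i::int. euclidean :: bool topology" UNIV U x] by auto
    \<comment> \<open>A basic open set restricts finitely many coordinates, and these fit into one
      symmetric window.\<close>
    obtain N where N: "\<forall>i\<in>{i. V i \<noteq> UNIV}. \<bar>i\<bar> \<le> N"
      using V(2) bdd_above_finite[of "abs ` {i. V i \<noteq> UNIV}"] by (auto simp: bdd_above_def)
    have "y \<in> U" if "\<forall>j. \<bar>j\<bar> \<le> N \<longrightarrow> y j = x j" for y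
    proof -
      have "y i \<in> V i" for i
      proof (cases "V i = UNIV")
        case False
        then have "y i = x i"
          using N that by auto
        then show ?thesis
          using V(1) by auto
      qed simp
      then show ?thesis
        using V(3) by auto
    qed
    then show "\<exists>N. \<forall>y. (\<forall>j. \<bar>j\<bar> \<le> N \<longrightarrow> y j = x j) \<longrightarrow> y \<in> U"
      by blast
  qed
next
  assume *: "\<forall>x\<in>U. \<exists>N. \<forall>y. (\<forall>j. \<bar>j\<bar> \<le> N \<longrightarrow> y j = x j) \<longrightarrow> y \<in> U"
  show "open U"
  proof (rule Topological_Spaces.openI)
    fix x assume "x \<in> U"
    then obtain N where N: "\<And>y. (\<forall>j. \<bar>j\<bar> \<le> N \<longrightarrow> y j = x j) \<Longrightarrow> y \<in> U"
      using * by blast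
    let ?C = "\<Pi>\<^sub>E j\<in>UNIV. if \<bar>j\<bar> \<le> N then {x j} else UNIV"
    have "{j. (if \<bar>j\<bar> \<le> N then {x j} else UNIV) \<noteq> UNIV} \<subseteq> {-N..N}"
      by (auto split: if_splits)
    then have "finite {j. (if \<bar>j\<bar> \<le> N then {x j} else UNIV) \<noteq> UNIV}"
      by (rule finite_subset) simp
    then have "open ?C"
      by (intro open_PiE) (auto intro: open_bool_set)
    moreover have "x \<in> ?C" "?C \<subseteq> U"
      by (auto simp: PiE_iff split: if_splits intro!: N)
    ultimately show "\<exists>T. open T \<and> x \<in> T \<and> T \<subseteq> U"
      by blast
  qed
qed

lemma open_cylinder:
  "open {y :: int \<Rightarrow> bool. \<forall>j. \<bar>j\<bar> \<le> N \<longrightarrow> y j = x j}"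
  unfolding open_bool_fun_iff by auto

lemma closure_bool_fun_iff:
  fixes S :: "(int \<Rightarrow> bool) set"
  shows "x \<in> closure S \<longleftrightarrow> (\<forall>N. \<exists>y\<in>S. \<forall>j. \<bar>j\<bar> \<le> N \<longrightarrow> y j = x j)"
proof
  assume x: "x \<in> closure S"
  show "\<forall>N. \<exists>y\<in>S. \<forall>j. \<bar>j\<bar> \<le> N \<longrightarrow> y j = x j"
  proof
    fix N
    show "\<exists>y\<in>S. \<forall>j. \<bar>j\<bar> \<le> N \<longrightarrow> y j = x j"
      using open_Int_closure_eq_empty[OF open_cylinder[of N x], of S] x by auto
  qed
next
  assume *: "\<forall>N. \<exists>y\<in>S. \<forall>j. \<bar>j\<bar> \<le> N \<longrightarrow> y j = x j"
  show "x \<in> closure S"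
  proof (rule ccontr)
    assume "x \<notin> closure S"
    then obtain N where N: "\<forall>y. (\<forall>j. \<bar>j\<bar> \<le> N \<longrightarrow> y j = x j) \<longrightarrow> y \<in> - closure S"
      using iffD1[OF open_bool_fun_iff open_Compl[OF closed_closure[of S]], THEN bspec, of x] by auto
    obtain y where "y \<in> S" "\<forall>j. \<bar>j\<bar> \<le> N \<longrightarrow> y j = x j"
      using * by blast
    then show False
      using N closure_subset[of S] by auto
  qed
qed

lemma compact_UNIV_bool_fun: "compact (UNIV :: (int \<Rightarrow> bool) set)"
proof -
  have "compact_space (euclidean :: bool topology)"
    by (simp add: compact_space_def finite_imp_compact)
  then have "compact_space (product_topology (\<lambda>i::int. euclidean :: bool topology) UNIV)"
    unfolding compact_space_product_topology by blast
  then show ?thesis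
    by (simp add: euclidean_product_topology compact_space_def)
qed

text \<open>This is the Curtis-Hedlund-Lyndon argument. Each point of \<open>X\<close> has a
  cylinder on which coordinate 0 of \<open>f\<close> is constant; finitely many of them cover
  \<open>X\<close> by compactness, and a common bound on their windows serves for all
  points.\<close>

lemma continuous_on_bool_fun_local:
  fixes f :: "(int \<Rightarrow> bool) \<Rightarrow> int \<Rightarrow> bool"
  assumes "compact X" and f: "continuous_on X f"
  obtains N where "0 \<le> N"
    and "\<And>x y. x \<in> X \<Longrightarrow> y \<in> X \<Longrightarrow> (\<And>j. \<bar>j\<bar> \<le> N \<Longrightarrow> x j = y j) \<Longrightarrow> f x 0 = f y 0"
proof -
  have "\<exists>N. \<forall>y\<in>X. (\<forall>j. \<bar>j\<bar> \<le> N \<longrightarrow> y j = x j) \<longrightarrow> f y 0 = f x 0" if "x \<in> X" for x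
  proof -
    have "open {y :: int \<Rightarrow> bool. y 0 = f x 0}"
      using open_cylinder[of 0 "f x"] by simp
    then obtain A where A: "open A" "A \<inter> X = f -` {y. y 0 = f x 0} \<inter> X"
      using f unfolding continuous_on_open_invariant by meson
    moreover have "x \<in> A"
      using A(2) that by auto
    ultimately obtain N where N: "\<forall>y. (\<forall>j. \<bar>j\<bar> \<le> N \<longrightarrow> y j = x j) \<longrightarrow> y \<in> A"
      unfolding open_bool_fun_iff by blast
    have "\<forall>y\<in>X. (\<forall>j. \<bar>j\<bar> \<le> N \<longrightarrow> y j = x j) \<longrightarrow> f y 0 = f x 0"
      using N A(2) by blast
    then show ?thesis ..
  qed
  then obtain M where M: "\<And>x y. x \<in> X \<Longrightarrow> y \<in> X \<Longrightarrow> (\<forall>j. \<bar>j\<bar> \<le> M x \<longrightarrow> y j = x j) \<Longrightarrow> f y 0 = f x 0"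
    by metis
  define C where "C x = {y :: int \<Rightarrow> bool. \<forall>j. \<bar>j\<bar> \<le> M x \<longrightarrow> y j = x j}" for x
  obtain D where D: "D \<subseteq> X" "finite D" "X \<subseteq> (\<Union>x\<in>D. C x)"
  proof (rule compactE_image[OF \<open>compact X\<close>, of X C])
    show "open (C x)" for x
      unfolding C_def by (rule open_cylinder)
    show "X \<subseteq> (\<Union>x\<in>X. C x)"
      unfolding C_def by auto
  qed
  obtain N where N: "\<forall>x\<in>D. M x \<le> N"
    using D(2) bdd_above_finite[of "M ` D"] by (auto simp: bdd_above_def)
  show ?thesis
  proof (rule that[of "max 0 N"])
    fix x y assume xy: "x \<in> X" "y \<in> X" "\<And>j. \<bar>j\<bar> \<le> max 0 N \<Longrightarrow> x j = y j"
    obtain z where z: "z \<in> D" "x \<in> C z"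
      using D(3) xy(1) by auto
    then have "y \<in> C z"
      using xy(3) N unfolding C_def by fastforce
    then show "f x 0 = f y 0"
      using M[of z x] M[of z y] z D(1) xy unfolding C_def by auto
  qed simp
qed

lemma int_iterate_shift_fun: "int_iterate shift n x = (\<lambda>j. x (j + n))"
  by (simp add: fun_eq_iff int_iterate_shift)

lemma continuous_int_iterate_shift: "continuous_on S (int_iterate shift n)"
proof -
  have "continuous_on S (\<lambda>x :: int \<Rightarrow> bool. \<lambda>j. x (j + n))"
    by (intro continuous_on_coordinatewise_then_product) (auto intro: continuous_on_subset[OF continuous_on_product_coordinates])
  then show ?thesis
    by (simp add: int_iterate_shift_fun[abs_def])
qed

section \<open>Residues under translation\<close>

lemma mod_add_right_cancel:
  "(c + r) mod n = (d + r) mod n \<Longrightarrow> c mod n = d mod n" for c d r n :: int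
  by (metis add_diff_cancel_right' mod_diff_left_eq)

text \<open>Adding \<open>r\<close> is injective on residue classes. Translates of a set in F are
  later compared with F through this count alone.\<close>

lemma card_residues_translate:
  "card ((\<lambda>x. (x + r) mod n) ` S) = card ((\<lambda>x. x mod n) ` S)" for r n :: int
proof -
  have "inj_on (\<lambda>c. (c + r) mod n) ((\<lambda>x. x mod n) ` S)"
    by (rule inj_onI) (metis (no_types, lifting) imageE mod_add_right_cancel mod_mod_trivial)
  then have "card ((\<lambda>c. (c + r) mod n) ` (\<lambda>x. x mod n) ` S) = card ((\<lambda>x. x mod n) ` S)"
    by (rule card_image)
  then show ?thesis
    by (simp add: image_image mod_simps)
qed

section \<open>Membership in the subshift, and shift powers as automorphisms\<close>

lemma mem_free_integers: "n \<in> free_integers B \<longleftrightarrow> (\<forall>b\<in>B. \<not> int b dvd n)"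
  by (auto simp: free_integers_def dvd_def)

lemma mem_X_eta:
  "x \<in> X_eta B \<longleftrightarrow> (\<forall>N. \<exists>r. \<forall>j. \<bar>j\<bar> \<le> N \<longrightarrow> (x j \<longleftrightarrow> j + r \<in> free_integers B))"
  by (simp add: X_eta_def closure_bool_fun_iff int_iterate_shift_fun eta_def eq_commute)

lemma translate_eta_in_X_eta: "(\<lambda>j. j + r \<in> free_integers B) \<in> X_eta B"
  by (auto simp: mem_X_eta)

lemma translate_in_X_eta:
  assumes "x \<in> X_eta B"
  shows "(\<lambda>j. x (j + n)) \<in> X_eta B"
  unfolding mem_X_eta
proof
  fix N
  obtain r where r: "\<forall>j. \<bar>j\<bar> \<le> N + \<bar>n\<bar> \<longrightarrow> (x j \<longleftrightarrow> j + r \<in> free_integers B)"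
    using assms unfolding mem_X_eta by blast
  have "\<forall>j. \<bar>j\<bar> \<le> N \<longrightarrow> (x (j + n) \<longleftrightarrow> j + (n + r) \<in> free_integers B)"
    using r by (auto simp: add.assoc[symmetric])
  then show "\<exists>r. \<forall>j. \<bar>j\<bar> \<le> N \<longrightarrow> (x (j + n) \<longleftrightarrow> j + r \<in> free_integers B)" ..
qed

lemma compact_X_eta: "compact (X_eta B)"
  using compact_Int_closed[OF compact_UNIV_bool_fun, of "X_eta B"] by (simp add: X_eta_def)

lemma shift_power_in_Aut: "restrict (int_iterate shift n) (X_eta B) \<in> Aut (X_eta B) shift"
proof -
  let ?f = "\<lambda>n. restrict (int_iterate shift n) (X_eta B)"
  have mem: "int_iterate shift k x \<in> X_eta B" if "x \<in> X_eta B" for x k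
    using translate_in_X_eta[OF that] by (simp add: int_iterate_shift_fun)
  have cont: "continuous_on (X_eta B) (?f k)" for k
    using continuous_int_iterate_shift[of "X_eta B" k]
    by (rule continuous_on_cong[THEN iffD1, rotated 2]) auto
  have inv: "?f (- k) (?f k x) = x" if "x \<in> X_eta B" for x k
    using that mem by (simp add: int_iterate_shift_fun)
  have "homeomorphism (X_eta B) (X_eta B) (?f n) (?f (- n))"
    using inv[of _ n] inv[of _ "- n"] mem cont by (intro homeomorphismI) auto
  moreover have "?f n (shift x) = shift (?f n x)" if "x \<in> X_eta B" for x
    using that translate_in_X_eta[OF that, of 1]
    by (auto simp: shift_def int_iterate_shift_fun algebra_simps)
  ultimately show ?thesis
    unfolding Aut_def mem_Collect_eq by (intro conjI exI ballI restrict_extensional)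
qed

section \<open>Occurrences of finite patterns in F\<close>

locale hereditary_B_free =
  fixes B :: "nat set"
  assumes zero_notin: "0 \<notin> B" and prim: "primitive_set B" and not_one: "B \<noteq> {1}"
    and hered: "hereditary (X_eta B)"
begin

abbreviation F where "F \<equiv> free_integers B"
abbreviation X where "X \<equiv> X_eta B"

text \<open>Since 1 divides everything, primitivity would leave it as the only element. The gain is
  that 1 and -1 lie in F.\<close>

lemma one_notin: "1 \<notin> B"
proof
  assume one: "1 \<in> B"
  then have "b = 1" if "b \<in> B" for b
    using prim that unfolding primitive_set_def by (metis one_dvd)
  then show False
    using one not_one by blast
qed

lemma unit_mem: "1 \<in> F" "-1 \<in> F"
  using one_notin by (auto simp: mem_free_integers)

lemma F_mod_b: "x \<in> F \<Longrightarrow> b \<in> B \<Longrightarrow> \<not> int b dvd x"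
  by (simp add: mem_free_integers)

lemma finite_residues: "b \<in> B \<Longrightarrow> finite ((\<lambda>x. x mod int b) ` S)"
  using zero_notin by (cases "b = 0") (auto intro: finite_subset[of _ "{0..<int b}"])

lemma X_down: "x \<in> X \<Longrightarrow> (\<And>j. y j \<Longrightarrow> x j) \<Longrightarrow> y \<in> X"
  using hered unfolding hereditary_def by (auto simp: le_fun_def)

lemma translate_subset_F_in_X:
  assumes "\<forall>a\<in>A. a + r \<in> F"
  shows "(\<lambda>j. j \<in> A) \<in> X"
  using translate_eta_in_X_eta by (rule X_down) (use assms in auto)

lemma empty_in_X: "(\<lambda>j. False) \<in> X"
  using translate_subset_F_in_X[of "{}"] by simp

lemma exact_translate:
  assumes "(\<lambda>j. j \<in> A) \<in> X"
  obtains r where "\<And>j. \<bar>j\<bar> \<le> N \<Longrightarrow> j \<in> A \<longleftrightarrow> j + r \<in> F"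
  using assms unfolding mem_X_eta by blast

text \<open>Meant for images under an automorphism, of which only some points are known: these can
  be moved into F together.\<close>

lemma finite_subset_translate:
  assumes "(\<lambda>j. j \<in> S) \<in> X" "finite A" "A \<subseteq> S"
  obtains r where "\<And>a. a \<in> A \<Longrightarrow> a + r \<in> F"
proof -
  obtain N where N: "\<forall>a\<in>A. \<bar>a\<bar> \<le> N"
    using assms(2) bdd_above_finite[of "abs ` A"] by (auto simp: bdd_above_def)
  obtain r where "\<And>j. \<bar>j\<bar> \<le> N \<Longrightarrow> j \<in> S \<longleftrightarrow> j + r \<in> F"
    using exact_translate[OF assms(1), of N] by blast
  then show ?thesis
    using that N assms(3) by blast
qed

text \<open>If F were bounded by \<open>k\<close>, an exact occurrence of a single point at
  \<open>r\<close> would have a window wide enough to contain all of F. Then \<open>r\<close> would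
  be the only element of F, which contains both 1 and -1.\<close>

lemma infinite_F: "infinite F"
proof
  assume "finite F"
  then obtain k where k: "\<forall>a\<in>F. \<bar>a\<bar> \<le> k"
    using bdd_above_finite[of "abs ` F"] by (auto simp: bdd_above_def)
  have "(\<lambda>j. j \<in> {0}) \<in> X"
    using unit_mem by (intro translate_subset_F_in_X[of _ 1]) auto
  then obtain r where r: "\<And>j. \<bar>j\<bar> \<le> 2 * k \<Longrightarrow> j \<in> {0} \<longleftrightarrow> j + r \<in> F"
    using exact_translate[of "{0}" "2 * k"] by blast
  have "1 \<le> k"
    using k unit_mem by force
  then have "\<bar>r\<bar> \<le> k"
    using r[of 0] k by auto
  then have "1 - r = 0" "- 1 - r = 0"
    using r[of "1 - r"] r[of "- 1 - r"] unit_mem \<open>1 \<le> k\<close> by auto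
  then show False
    by simp
qed

text \<open>If \<open>r\<close> were small, the window of the exact occurrence of \<open>A\<close>
  would contain \<open>C\<close>, which has more points of F than \<open>A\<close> can account
  for.\<close>

lemma far_translate:
  assumes "(\<lambda>j. j \<in> A) \<in> X" "finite A"
  obtains r where "\<And>a. a \<in> A \<Longrightarrow> a + r \<in> F \<and> k < \<bar>a + r\<bar>"
proof -
  obtain m where m: "\<forall>a\<in>A. \<bar>a\<bar> \<le> m"
    using assms(2) bdd_above_finite[of "abs ` A"] by (auto simp: bdd_above_def)
  obtain C where C: "C \<subseteq> F" "finite C" "card C = Suc (card A)"
    using infinite_F by (meson infinite_arbitrarily_large)
  obtain l where l: "\<forall>a\<in>C. \<bar>a\<bar> \<le> l"
    using C(2) bdd_above_finite[of "abs ` C"] by (auto simp: bdd_above_def)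
  define n where "n = \<bar>k\<bar> + \<bar>m\<bar> + \<bar>l\<bar>"
  obtain r where r: "\<And>j. \<bar>j\<bar> \<le> 2 * n \<Longrightarrow> j \<in> A \<longleftrightarrow> j + r \<in> F"
    using exact_translate[OF assms(1)] by blast
  have "n < \<bar>r\<bar>"
  proof (rule ccontr)
    assume "\<not> n < \<bar>r\<bar>"
    then have "\<bar>c - r\<bar> \<le> 2 * n" if "c \<in> C" for c
      using l that unfolding n_def by fastforce
    then have "(\<lambda>c. c - r) ` C \<subseteq> A"
      using r C(1) by force
    then have "card ((\<lambda>c. c - r) ` C) \<le> card A"
      using assms(2) by (rule card_mono[rotated])
    moreover have "card ((\<lambda>c. c - r) ` C) = card C"
      by (intro card_image) (auto simp: inj_on_def)
    ultimately show False
      using C(3) by simp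
  qed
  show ?thesis
  proof (rule that[of r])
    fix a assume "a \<in> A"
    then have "\<bar>a\<bar> \<le> m"
      using m by blast
    then show "a + r \<in> F \<and> k < \<bar>a + r\<bar>"
      using r[of a] \<open>a \<in> A\<close> \<open>n < \<bar>r\<bar>\<close> unfolding n_def by auto
  qed
qed

section \<open>Residue classes of F and rigid sets\<close>

lemma far_residues:
  assumes "b \<in> B"
  shows "(\<lambda>x. x mod int b) ` {x \<in> F. k < \<bar>x\<bar>} = (\<lambda>x. x mod int b) ` F"
proof -
  let ?m = "\<lambda>x. x mod int b"
  note fin = finite_residues[OF assms]
  obtain A where A: "A \<subseteq> F" "finite A" "?m ` A = ?m ` F"
    using finite_subset_image[OF fin[of F] order_refl] by metis
  have "(\<lambda>j. j \<in> A) \<in> X"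
    using A(1) by (intro translate_subset_F_in_X[of _ 0]) auto
  then obtain r where r: "\<And>a. a \<in> A \<Longrightarrow> a + r \<in> F \<and> k < \<bar>a + r\<bar>"
    using far_translate[OF _ A(2), of k] by blast
  \<comment> \<open>Translation by \<open>r\<close> may permute classes but keeps their number, so
    the far part of F meets at least as many classes as F; being contained in F, it meets the same
    ones.\<close>
  have "card (?m ` F) = card ((\<lambda>x. ?m (x + r)) ` A)"
    by (simp add: card_residues_translate A(3))
  also have "\<dots> \<le> card (?m ` {x \<in> F. k < \<bar>x\<bar>})"
    using r by (intro card_mono fin) auto
  finally show ?thesis
    by (intro card_seteq fin) auto
qed

lemma sparse_residues:
  assumes "b \<in> B"
  obtains E where "finite E" "E \<subseteq> F" "(\<lambda>x. x mod int b) ` E = (\<lambda>x. x mod int b) ` F"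
    "\<And>x. x \<in> E \<Longrightarrow> k < \<bar>x\<bar>" "pairwise (\<lambda>x y. D < \<bar>x - y\<bar>) E"
proof -
  let ?m = "\<lambda>x. x mod int b"
  have "\<exists>E. finite E \<and> E \<subseteq> F \<and> ?m ` E = C \<and> (\<forall>x\<in>E. k < \<bar>x\<bar>) \<and> pairwise (\<lambda>x y. D < \<bar>x - y\<bar>) E"
    if "finite C" "C \<subseteq> ?m ` F" for C
    using that
  proof (induction C rule: finite_induct)
    case empty
    show ?case
      by (intro exI[of _ "{}"]) auto
  next
    case (insert c C)
    then obtain E where E: "finite E" "E \<subseteq> F" "?m ` E = C" "\<forall>x\<in>E. k < \<bar>x\<bar>" "pairwise (\<lambda>x y. D < \<bar>x - y\<bar>) E"
      by auto
    obtain l where l: "\<forall>a\<in>E. \<bar>a\<bar> \<le> l"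
      using E(1) bdd_above_finite[of "abs ` E"] by (auto simp: bdd_above_def)
    \<comment> \<open>The class \<open>c\<close> has representatives in F beyond any bound, so the
      new point can be taken far from the origin and from all points already chosen.\<close>
    have "c \<in> ?m ` {x \<in> F. \<bar>k\<bar> + \<bar>l\<bar> + \<bar>D\<bar> < \<bar>x\<bar>}"
      using insert.prems unfolding far_residues[OF assms] by blast
    then obtain e where e: "e \<in> F" "?m e = c" "\<bar>k\<bar> + \<bar>l\<bar> + \<bar>D\<bar> < \<bar>e\<bar>"
      by auto
    have "D < \<bar>e - x\<bar> \<and> D < \<bar>x - e\<bar>" if "x \<in> E" for x
      using l that e(3) by fastforce
    then show ?case
      using E e by (intro exI[of _ "insert e E"]) (auto simp: pairwise_insert)
  qed
  from this[OF finite_residues[OF assms] order_refl] show ?thesis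
    by (elim exE conjE) (rule that, auto)
qed

text \<open>\<open>E + r\<close> lies in F and meets as many classes as F, hence all of them. So
  \<open>p + r\<close> is congruent to some \<open>e + r\<close>, and \<open>p\<close> to
  \<open>e\<close>, an element of F.\<close>

lemma rigid:
  assumes "b \<in> B" "E \<subseteq> F" "(\<lambda>x. x mod int b) ` E = (\<lambda>x. x mod int b) ` F"
    and E: "\<And>e. e \<in> E \<Longrightarrow> e + r \<in> F" and p: "p + r \<in> F"
  shows "\<not> int b dvd p"
proof -
  let ?m = "\<lambda>x. x mod int b"
  have "(\<lambda>x. ?m (x + r)) ` E = ?m ` F"
  proof (rule card_subset_eq)
    show "finite (?m ` F)"
      using assms(1) by (rule finite_residues)
    show "(\<lambda>x. ?m (x + r)) ` E \<subseteq> ?m ` F"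
      using E by auto
    show "card ((\<lambda>x. ?m (x + r)) ` E) = card (?m ` F)"
      by (simp only: card_residues_translate assms(3))
  qed
  then have "?m (p + r) \<in> (\<lambda>x. ?m (x + r)) ` E"
    using p by simp
  then obtain e where "e \<in> E" "?m p = ?m e"
    using mod_add_right_cancel by blast
  then show ?thesis
    using F_mod_b[OF _ assms(1), of e] assms(2) by (auto simp: dvd_eq_mod_eq_0)
qed

end

section \<open>Sliding block codes of radius N\<close>

locale B_free_code = hereditary_B_free +
  fixes \<tau> :: "(int \<Rightarrow> bool) \<Rightarrow> int \<Rightarrow> bool" and N :: int
  assumes maps: "x \<in> X \<Longrightarrow> \<tau> x \<in> X"
    and inj: "inj_on \<tau> X"
    and comm_shift: "x \<in> X \<Longrightarrow> \<tau> (shift x) = shift (\<tau> x)"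
    and N_nonneg: "0 \<le> N"
    and local_0: "x \<in> X \<Longrightarrow> y \<in> X \<Longrightarrow> (\<And>j. \<bar>j\<bar> \<le> N \<Longrightarrow> x j = y j) \<Longrightarrow> \<tau> x 0 = \<tau> y 0"
begin

lemma comm:
  assumes "x \<in> X"
  shows "\<tau> (\<lambda>j. x (j + n)) = (\<lambda>j. \<tau> x (j + n))"
proof -
  have nat: "\<tau> (\<lambda>j. x (j + int k)) = (\<lambda>j. \<tau> x (j + int k))" if "x \<in> X" for x k
  proof (induction k)
    case (Suc k)
    have "shift (\<lambda>j. y (j + int k)) = (\<lambda>j. y (j + int (Suc k)))" for y
      by (simp add: shift_def algebra_simps)
    then show ?case
      using comm_shift[OF translate_in_X_eta[OF that, of "int k"]] Suc.IH by metis
  qed simp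
  show ?thesis
  proof (cases "0 \<le> n")
    case True
    then show ?thesis
      using nat[OF assms, of "nat n"] by simp
  next
    case False
    \<comment> \<open>The natural case, applied to the translated point, moves it back to
      \<open>x\<close>.\<close>
    then have "\<tau> x = (\<lambda>j. \<tau> (\<lambda>j. x (j + n)) (j - n))"
      using nat[OF translate_in_X_eta[OF assms, of n], of "nat (- n)"] by simp
    then show ?thesis
      by (metis add_diff_cancel_right')
  qed
qed

lemma local:
  assumes "x \<in> X" "y \<in> X" "\<And>i. \<bar>i - j\<bar> \<le> N \<Longrightarrow> x i = y i"
  shows "\<tau> x j = \<tau> y j"
proof -
  have "\<tau> (\<lambda>i. x (i + j)) 0 = \<tau> (\<lambda>i. y (i + j)) 0"
    using assms by (intro local_0 translate_in_X_eta) auto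
  then show ?thesis
    by (simp add: comm[OF assms(1)] comm[OF assms(2)])
qed

text \<open>The map on sets of integers induced by \<tau>; it is controlled only for sets whose
  indicator lies in \<open>X\<close>.\<close>

definition img :: "int set \<Rightarrow> int set" where
  "img A = {j. \<tau> (\<lambda>j. j \<in> A) j}"

lemma img_in_X: "(\<lambda>j. j \<in> A) \<in> X \<Longrightarrow> (\<lambda>j. j \<in> img A) \<in> X"
  by (simp add: img_def maps)

lemma img_inj:
  assumes "(\<lambda>j. j \<in> A) \<in> X" "(\<lambda>j. j \<in> C) \<in> X" "img A = img C"
  shows "A = C"
proof -
  have "\<tau> (\<lambda>j. j \<in> A) = \<tau> (\<lambda>j. j \<in> C)"
    using assms(3) by (auto simp: img_def fun_eq_iff)
  then have "(\<lambda>j. j \<in> A) = (\<lambda>j. j \<in> C)"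
    using inj assms(1,2) by (auto dest: inj_onD)
  then show ?thesis
    by (auto simp: fun_eq_iff)
qed

text \<open>The empty set is shift invariant, so its image is constant. The constant True is
  excluded: \<open>B\<close> is nonempty because F has gaps, and in any translate of F a window of
  length \<open>b\<close> contains a multiple of \<open>b\<close>.\<close>

lemma img_empty: "img {} = {}"
proof -
  define c where "c = \<tau> (\<lambda>j. False)"
  have "c \<in> X"
    unfolding c_def by (intro maps empty_in_X)
  have const: "c j = c 0" for j
    using comm[OF empty_in_X, of j] unfolding c_def by (metis add_0)
  obtain s where "0 + s \<notin> F"
    using exact_translate[of "{}" 0] empty_in_X by auto
  then obtain b where b: "b \<in> B"
    by (auto simp: mem_free_integers)
  then have "0 < int b"
    using zero_notin by (auto intro!: gr0I)
  obtain r where r: "\<forall>j. \<bar>j\<bar> \<le> int b \<longrightarrow> (c j \<longleftrightarrow> j + r \<in> F)"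
    using \<open>c \<in> X\<close> unfolding mem_X_eta by blast
  let ?j = "(- r) mod int b"
  have "int b dvd ?j + r"
    by (simp add: dvd_eq_mod_eq_0 mod_simps)
  then have "?j + r \<notin> F"
    using F_mod_b b by blast
  moreover have "\<bar>?j\<bar> \<le> int b"
    using \<open>0 < int b\<close> pos_mod_sign[of "int b" "- r"] pos_mod_bound[of "int b" "- r"] by linarith
  ultimately have "\<not> c 0"
    using r const by blast
  then show ?thesis
    using const by (auto simp: img_def c_def)
qed

lemma img_translate:
  assumes "(\<lambda>j. j \<in> A) \<in> X"
  shows "img ((\<lambda>a. a + n) ` A) = (\<lambda>a. a + n) ` img A"
proof -
  \<comment> \<open>Membership in a translate is rewritten with \<open>j + (- n)\<close>, the form
    to which \<open>comm\<close> applies.\<close>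
  have mem: "j \<in> (\<lambda>a. a + n) ` S \<longleftrightarrow> j + (- n) \<in> S" for j and S :: "int set"
    by force
  show ?thesis
    using comm[OF assms, of "- n"] by (simp add: set_eq_iff mem) (simp add: img_def mem)
qed

text \<open>A window of radius \<open>N\<close> meets at most one of the two sets. There the union
  looks like that set and the other one looks empty, with empty image.\<close>

lemma img_Un:
  assumes X: "(\<lambda>j. j \<in> A \<union> E) \<in> X" and far: "\<And>a e. a \<in> A \<Longrightarrow> e \<in> E \<Longrightarrow> 2 * N < \<bar>a - e\<bar>"
  shows "img (A \<union> E) = img A \<union> img E"
proof -
  have A: "(\<lambda>j. j \<in> A) \<in> X" and E: "(\<lambda>j. j \<in> E) \<in> X"
    by (rule X_down[OF X]; simp)+
  have "j \<in> img (A \<union> E) \<longleftrightarrow> j \<in> img A \<or> j \<in> img E" for j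
  proof (cases "\<exists>a\<in>A. \<bar>a - j\<bar> \<le> N")
    case True
    then have none: "i \<notin> E" if "\<bar>i - j\<bar> \<le> N" for i
      using far that by fastforce
    have "\<tau> (\<lambda>j. j \<in> A \<union> E) j = \<tau> (\<lambda>j. j \<in> A) j"
      by (rule local[OF X A]) (use none in auto)
    moreover have "\<tau> (\<lambda>j. j \<in> E) j = \<tau> (\<lambda>j. j \<in> {}) j"
      by (rule local[OF E]) (use none empty_in_X in auto)
    ultimately show ?thesis
      using img_empty by (simp add: img_def)
  next
    case False
    have "\<tau> (\<lambda>j. j \<in> A \<union> E) j = \<tau> (\<lambda>j. j \<in> E) j"
      by (rule local[OF X E]) (use False in auto)
    moreover have "\<tau> (\<lambda>j. j \<in> A) j = \<tau> (\<lambda>j. j \<in> {}) j"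
      by (rule local[OF A]) (use False empty_in_X in auto)
    ultimately show ?thesis
      using img_empty by (simp add: img_def)
  qed
  then show ?thesis
    by blast
qed

lemma singleton_in_X: "(\<lambda>j. j \<in> {a}) \<in> X"
  using unit_mem by (intro translate_subset_F_in_X[of _ "1 - a"]) auto

lemma img_singleton: "img {a} = (\<lambda>g. g + a) ` img {0}"
  using img_translate[OF singleton_in_X[of 0], of a] by simp

lemma img_sparse:
  assumes "finite E" "(\<lambda>j. j \<in> E) \<in> X" "pairwise (\<lambda>x y. 2 * N < \<bar>x - y\<bar>) E"
  shows "img E = (\<Union>e\<in>E. (\<lambda>g. g + e) ` img {0})"
  using assms
proof (induction E rule: finite_induct)
  case empty
  show ?case
    by (simp add: img_empty)
next
  case (insert e E)
  have "(\<lambda>j. j \<in> E) \<in> X"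
    by (rule X_down[OF insert.prems(1)]) simp
  then have "img E = (\<Union>e\<in>E. (\<lambda>g. g + e) ` img {0})"
    using insert by (auto simp: pairwise_insert)
  moreover have "img ({e} \<union> E) = img {e} \<union> img E"
    using insert by (intro img_Un) (auto simp: pairwise_insert)
  ultimately show ?case
    using img_singleton[of e] by simp
qed

section \<open>The image of a single point\<close>

lemma img_0_difference:
  assumes f: "f \<in> img {0}" and g: "g \<in> img {0}" and x: "x \<in> F"
  shows "x + (g - f) \<in> F"
proof (rule ccontr)
  assume "x + (g - f) \<notin> F"
  then obtain b where b: "b \<in> B" "int b dvd x + (g - f)"
    by (auto simp: mem_free_integers)
  obtain E where E: "finite E" "E \<subseteq> F" "(\<lambda>x. x mod int b) ` E = (\<lambda>x. x mod int b) ` F"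
    "pairwise (\<lambda>x y. 2 * N < \<bar>x - y\<bar>) E"
    using sparse_residues[OF b(1)] by metis
  \<comment> \<open>\<open>e\<close> replaces \<open>x\<close> modulo \<open>b\<close>, so that
    \<open>img E\<close> contains \<open>g + e\<close> besides all of \<open>E + f\<close>.\<close>
  obtain e where e: "e \<in> E" "e mod int b = x mod int b"
    using x E(3) by (metis (no_types, lifting) imageE imageI)
  have EX: "(\<lambda>j. j \<in> E) \<in> X"
    using E(2) by (intro translate_subset_F_in_X[of _ 0]) auto
  have "insert (g + e) ((\<lambda>a. f + a) ` E) \<subseteq> img E"
    using img_sparse[OF E(1) EX E(4)] f g e(1) by auto
  then obtain r where r: "\<And>a. a \<in> insert (g + e) ((\<lambda>a. f + a) ` E) \<Longrightarrow> a + r \<in> F"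
    using finite_subset_translate[OF img_in_X[OF EX], of "insert (g + e) ((\<lambda>a. f + a) ` E)"] E(1) by blast
  \<comment> \<open>Translation by \<open>f + r\<close> carries both \<open>E\<close> and
    \<open>e + (g - f)\<close> into F, so \<open>E\<close> is rigid against this point.\<close>
  have "\<not> int b dvd e + (g - f)"
  proof (rule rigid[OF b(1) E(2,3)])
    show "a + (f + r) \<in> F" if "a \<in> E" for a
      using r[of "f + a"] that by (simp add: algebra_simps)
    show "e + (g - f) + (f + r) \<in> F"
      using r[of "g + e"] by (simp add: algebra_simps)
  qed
  moreover have "(e + (g - f)) mod int b = (x + (g - f)) mod int b"
    using e(2) by (metis mod_add_left_eq)
  ultimately show False
    using b(2) by (simp add: dvd_eq_mod_eq_0)
qed

text \<open>A nonzero period would put the whole progression 1 + d\<int> into F, although F has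
  arbitrarily long gaps because the empty set is in \<open>X\<close>.\<close>

lemma F_not_periodic:
  assumes "\<And>x. x \<in> F \<Longrightarrow> x + d \<in> F" "\<And>x. x \<in> F \<Longrightarrow> x - d \<in> F"
  shows "d = 0"
proof (rule ccontr)
  assume "d \<noteq> 0"
  have mult: "1 + d * k \<in> F" for k
  proof (induction k rule: int_induct[where k = 0])
    case base
    show ?case using unit_mem by simp
  next
    case (step1 i)
    then show ?case using assms(1)[of "1 + d * i"] by (simp add: algebra_simps)
  next
    case (step2 i)
    then show ?case using assms(2)[of "1 + d * i"] by (simp add: algebra_simps)
  qed
  obtain r where r: "\<And>j. \<bar>j\<bar> \<le> \<bar>d\<bar> \<Longrightarrow> j + r \<notin> F"
    using exact_translate[of "{}" "\<bar>d\<bar>"] empty_in_X by auto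
  let ?j = "(1 - r) mod d"
  have "?j + r = 1 + d * (- ((1 - r) div d))"
    by (simp add: minus_div_mult_eq_mod[symmetric] algebra_simps)
  then have "?j + r \<in> F"
    using mult by metis
  moreover have "\<bar>?j\<bar> \<le> \<bar>d\<bar>"
    using abs_mod_less[OF \<open>d \<noteq> 0\<close>, of "1 - r"] by linarith
  ultimately show False
    using r by blast
qed

text \<open>Injectivity separates this image from that of the empty set. For two of its points,
  \<open>img_0_difference\<close> in both orders makes their difference a period of F.\<close>

lemma img_0_singleton: obtains m where "img {0} = {m}"
proof -
  have "img {0} \<noteq> {}"
    using img_inj[OF singleton_in_X, of "{}" 0] empty_in_X img_empty by auto
  moreover have "f = g" if "f \<in> img {0}" "g \<in> img {0}" for f g
  proof -
    have "g - f = 0"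
      using img_0_difference[OF that] img_0_difference[OF that(2,1)]
      by (intro F_not_periodic) (simp_all add: algebra_simps)
    then show ?thesis
      by simp
  qed
  ultimately show ?thesis
    using that by blast
qed

section \<open>Images of finite sets, and passage to all points\<close>

lemma img_subset_translate:
  assumes m: "img {0} = {m}" and A: "finite A" "(\<lambda>j. j \<in> A) \<in> X" and p: "p \<in> img A"
  shows "p - m \<in> A"
proof (rule ccontr)
  assume "p - m \<notin> A"
  obtain l where l: "\<forall>a\<in>insert (p - m) A. \<bar>a\<bar> \<le> l"
    using A(1) bdd_above_finite[of "abs ` insert (p - m) A"] by (auto simp: bdd_above_def)
  \<comment> \<open>The window covers \<open>p - m\<close> as well as \<open>A\<close>, so exactness
    pushes \<open>p - m + r\<close> out of F.\<close>
  obtain r where r: "\<And>j. \<bar>j\<bar> \<le> l \<Longrightarrow> j \<in> A \<longleftrightarrow> j + r \<in> F"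
    using exact_translate[OF A(2), of l] by blast
  then have "p - m + r \<notin> F"
    using l \<open>p - m \<notin> A\<close> by blast
  then obtain b where b: "b \<in> B" "int b dvd p - m + r"
    by (auto simp: mem_free_integers)
  let ?A = "(\<lambda>a. a + r) ` A"
  have AF: "?A \<subseteq> F"
    using r l by auto
  \<comment> \<open>\<open>A + r\<close> lies within \<open>l + |r|\<close> of the origin, so this
    bound keeps \<open>E\<close> more than \<open>2 * N\<close> away from it.\<close>
  obtain E where E: "finite E" "E \<subseteq> F" "(\<lambda>x. x mod int b) ` E = (\<lambda>x. x mod int b) ` F"
    "\<And>x. x \<in> E \<Longrightarrow> l + \<bar>r\<bar> + 2 * N < \<bar>x\<bar>" "pairwise (\<lambda>x y. 2 * N < \<bar>x - y\<bar>) E"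
    using sparse_residues[OF b(1), of "l + \<bar>r\<bar> + 2 * N" "2 * N"] by metis
  have UX: "(\<lambda>j. j \<in> ?A \<union> E) \<in> X"
    using E(2) AF by (intro translate_subset_F_in_X[of _ 0]) auto
  have EX: "(\<lambda>j. j \<in> E) \<in> X"
    by (rule X_down[OF UX]) simp
  have "2 * N < \<bar>a + r - e\<bar>" if "a \<in> A" "e \<in> E" for a e
  proof -
    have "\<bar>a\<bar> \<le> l"
      using l that(1) by blast
    then show ?thesis
      using E(4)[OF that(2)] by linarith
  qed
  then have "img (?A \<union> E) = img ?A \<union> img E"
    using UX by (intro img_Un) auto
  moreover have "p + r \<in> img ?A"
    using img_translate[OF A(2)] p by blast
  moreover have "img E = (\<lambda>e. m + e) ` E"
    using img_sparse[OF E(1) EX E(5)] m by auto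
  ultimately have sub: "insert (p + r) ((\<lambda>e. m + e) ` E) \<subseteq> img (?A \<union> E)"
    by blast
  obtain s where s: "\<And>a. a \<in> insert (p + r) ((\<lambda>e. m + e) ` E) \<Longrightarrow> a + s \<in> F"
    using finite_subset_translate[OF img_in_X[OF UX] _ sub] E(1) by blast
  \<comment> \<open>Translation by \<open>m + s\<close> carries \<open>E\<close> into F through its
    image \<open>E + m\<close>, and \<open>p - m + r\<close> through the image point
    \<open>p + r\<close>.\<close>
  have "\<not> int b dvd p - m + r"
  proof (rule rigid[OF b(1) E(2,3)])
    show "a + (m + s) \<in> F" if "a \<in> E" for a
      using s[of "m + a"] that by (simp add: algebra_simps)
    show "p - m + r + (m + s) \<in> F"
      using s[of "p + r"] by (simp add: algebra_simps)
  qed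
  then show False
    using b(2) by blast
qed

text \<open>Moving \<open>img A\<close> back by \<open>m\<close> gives a subset \<open>?C\<close> of
  \<open>A\<close>. Were it proper, induction would give \<open>?C\<close> the same image as
  \<open>A\<close>, against injectivity.\<close>

lemma img_finite:
  assumes m: "img {0} = {m}" and A: "finite A" "(\<lambda>j. j \<in> A) \<in> X"
  shows "img A = (\<lambda>a. a + m) ` A"
  using A
proof (induction A rule: finite_psubset_induct)
  case (psubset A)
  let ?C = "(\<lambda>p. p - m) ` img A"
  have sub: "?C \<subseteq> A"
    using img_subset_translate[OF m psubset.hyps psubset.prems] by blast
  have img: "img A = (\<lambda>a. a + m) ` ?C"
    by (simp add: image_image)
  have "?C = A"
  proof (rule ccontr)
    assume "?C \<noteq> A"
    moreover have CX: "(\<lambda>j. j \<in> ?C) \<in> X"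
      by (rule X_down[OF psubset.prems]) (use sub in blast)
    ultimately have "img ?C = (\<lambda>a. a + m) ` ?C"
      using sub by (intro psubset.IH) auto
    then show False
      using img_inj[OF psubset.prems CX] img \<open>?C \<noteq> A\<close> by auto
  qed
  then show ?case
    using img by simp
qed

lemma code_is_shift: obtains m where "\<And>x. x \<in> X \<Longrightarrow> \<tau> x = int_iterate shift m x"
proof -
  obtain m where m: "img {0} = {m}"
    by (rule img_0_singleton)
  have "\<tau> x j = x (j - m)" if "x \<in> X" for x j
  proof -
    \<comment> \<open>Radius \<open>N + |m|\<close> covers both the block that determines \<tau> at
      \<open>j\<close> and the coordinate \<open>j - m\<close>, so \<open>x\<close> may be cut down
      to a finite set, still in \<open>X\<close> by heredity.\<close>
    define A where "A = {i \<in> {j - (N + \<bar>m\<bar>)..j + (N + \<bar>m\<bar>)}. x i}"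
    have fin: "finite A"
      unfolding A_def by (rule finite_subset[of _ "{j - (N + \<bar>m\<bar>)..j + (N + \<bar>m\<bar>)}"]) auto
    have AX: "(\<lambda>j. j \<in> A) \<in> X"
      by (rule X_down[OF that]) (simp add: A_def)
    have "\<tau> x j = \<tau> (\<lambda>j. j \<in> A) j"
      by (rule local[OF that AX]) (auto simp: A_def)
    also have "\<dots> = (j \<in> img A)"
      by (simp add: img_def)
    also have "\<dots> = (j - m \<in> A)"
      unfolding img_finite[OF m fin AX] by force
    also have "\<dots> = x (j - m)"
      using N_nonneg by (auto simp: A_def)
    finally show ?thesis .
  qed
  then show ?thesis
    \<comment> \<open>\<open>shift\<close> moves sets to the left, so translating them by
      \<open>m\<close> to the right is the power \<open>- m\<close>.\<close>
    by (intro that[of "- m"]) (simp add: int_iterate_shift_fun fun_eq_iff)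
qed

end

section \<open>The automorphism group\<close>

theorem theorem5p1:
  fixes B :: "nat set"
  assumes "0 \<notin> B"
    and "primitive_set B"
    and "B \<noteq> {1}"
    and "hereditary (X_eta B)"
  shows "Aut (X_eta B) shift = {restrict (int_iterate shift n) (X_eta B) | n :: int. True}"
proof (intro subset_antisym subsetI)
  fix \<tau> assume "\<tau> \<in> Aut (X_eta B) shift"
  then obtain \<sigma> where ext: "\<tau> \<in> extensional (X_eta B)" and hom: "homeomorphism (X_eta B) (X_eta B) \<tau> \<sigma>"
    and comm: "\<And>x. x \<in> X_eta B \<Longrightarrow> \<tau> (shift x) = shift (\<tau> x)"
    unfolding Aut_def by blast
  obtain N where N: "0 \<le> N"
    "\<And>x y. x \<in> X_eta B \<Longrightarrow> y \<in> X_eta B \<Longrightarrow> (\<And>j. \<bar>j\<bar> \<le> N \<Longrightarrow> x j = y j) \<Longrightarrow> \<tau> x 0 = \<tau> y 0"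
    using continuous_on_bool_fun_local[OF compact_X_eta homeomorphism_cont1[OF hom]] by blast
  interpret B_free_code B \<tau> N
  proof
    show "inj_on \<tau> (X_eta B)"
      by (rule inj_on_inverseI[of _ \<sigma>]) (rule homeomorphism_apply1[OF hom])
    show "\<tau> x \<in> X_eta B" if "x \<in> X_eta B" for x
      using homeomorphism_image1[OF hom] that by blast
  qed (use assms comm N in blast)+
  obtain m where "\<And>x. x \<in> X_eta B \<Longrightarrow> \<tau> x = int_iterate shift m x"
    using code_is_shift by blast
  \<comment> \<open>Both maps are \<open>undefined\<close> off \<open>X_eta B\<close>, so agreement
    on it gives equality.\<close>
  then have "\<tau> = restrict (int_iterate shift m) (X_eta B)"
    using ext by (auto intro: extensionalityI)
  then show "\<tau> \<in> {restrict (int_iterate shift n) (X_eta B) | n. True}"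
    by blast
qed (use shift_power_in_Aut in blast)

end
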